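(* Let $$\mathbb I=\{1\le i\le d-1\mid i\notin\{a_1,\dots,a_{k-1}\},\ \delta_1(\mathbf w_i)>\deg(\mathbf w_i)\}.$$ Then $$\mathbb I=\{1\le i\le d-1\mid i\notin\{a_1,\dots,a_{k-1}\},\ \delta_2(\mathbf w_i)>\deg(\mathbf w_i)\},$$ and $$\{\mathbf w_i\mid i\in\mathbb I\}\subseteq S'\setminus S\subseteq\{\mathbf w_i\mid i\in\mathbb I\}+\mathbb N\mathbf e_0+\mathbb N\mathbf e_d.$$
   Context: Let $\mathbb N$ be the set of non-negative integers, $k\ge 3$, and let $0=:a_0<a_1<\cdots<a_k=:d$ be integers with $\gcd(a_1,\dots,a_k)=1$. Put $A_1=\{0,a_1,\dots,a_k\}$, $A_2=\{d-a_i\mid 0\le i\le k\}$, and $\mathbf e_h=(h,d-h)$ for integers $0\le h\le d$. Let $S\subset\mathbb N^2$ be the additive monoid generated by $\mathbf e_{a_0},\dots,\mathbf e_{a_k}$, and $$S'=\{\mathbf u\in\mathbb N^2\mid \mathbf u+p\mathbf e_0\in S\text{ and }\mathbf u+p\mathbf e_d\in S\text{ for some }p\in\mathbb N\}.$$ For $\mathbf u=(u_1,u_2)$ with $d\mid u_1+u_2$ put $\deg(\mathbf u)=(u_1+u_2)/d$. For $i\in\{1,2\}$ let $\langle A_i\rangle$ be the submonoid of $\mathbb N$ generated by $A_i$. For $0\le j\le d-1$ let $\omega_i(j)=\min\{\alpha\in\langle A_i\rangle\mid\alpha\equiv j \bmod d\}$, and set $\omega_i(d):=0$. For $n\in\langle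 A_i\rangle$ let $\delta_i(n)$ be the minimum of $\sum_{a}x_a$ over all representations $n=\sum_{a\in A_i\setminus\{0\}}x_a a$ with $x_a\in\mathbb N$. For $0\le j\le d-1$ put $\mathbf w_j=(\omega_1(j),\omega_2(d-j))$, and write $\delta_1(\mathbf w_j)=\delta_1(\omega_1(j))$, $\delta_2(\mathbf w_j)=\delta_2(\omega_2(d-j))$. *)

theory Defs
  imports "HOL-Library.Product_Plus" "HOL-Library.Set_Algebras"
    "HOL-Number_Theory.Cong"
begin

inductive_set submonoid_gen :: "'a::comm_monoid_add set \<Rightarrow> 'a set" for G where
  zero: "0 \<in> submonoid_gen G"
| add: "g \<in> G \<Longrightarrow> x \<in> submonoid_gen G \<Longrightarrow> g + x \<in> submonoid_gen G"

definition nscale :: "nat \<Rightarrow> nat \<times> nat \<Rightarrow> nat \<times> nat" where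
  "nscale p u = (p * fst u, p * snd u)"

text \<open>
  Below, \<open>d\<close> is the largest of the given integers and \<open>A\<close> is the set
  \<open>A\<^sub>1 = {0, a\<^sub>1, \<dots>, a\<^sub>k}\<close>, so that \<open>A \<subseteq> {0..d}\<close> and all subtractions from \<open>d\<close> are exact.
\<close>

definition reflected :: "nat \<Rightarrow> nat set \<Rightarrow> nat set" where
  "reflected d A = (\<lambda>x. d - x) ` A"

definition evec :: "nat \<Rightarrow> nat \<Rightarrow> nat \<times> nat" where
  "evec d h = (h, d - h)"

definition S_monoid :: "nat \<Rightarrow> nat set \<Rightarrow> (nat \<times> nat) set" where
  "S_monoid d A = submonoid_gen (evec d ` A)"

definition S_prime :: "nat \<Rightarrow> nat set \<Rightarrow> (nat \<times> nat) set" where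
  "S_prime d A = {u. \<exists>p. u + nscale p (evec d 0) \<in> S_monoid d A
                       \<and> u + nscale p (evec d d) \<in> S_monoid d A}"

text \<open>
  The degree is only meaningful when \<open>d\<close> divides the coordinate sum; there \<open>div\<close> is
  exact division.
\<close>
definition degr :: "nat \<Rightarrow> nat \<times> nat \<Rightarrow> nat" where
  "degr d u = (fst u + snd u) div d"

text \<open>
  \<open>omega\<close> is only used for \<open>j \<le> d\<close>, with \<open>B\<close> either \<open>A\<close> or its reflection. The minimum
  exists because \<open>B\<close> contains \<open>d\<close> and has gcd 1.
\<close>
definition omega :: "nat \<Rightarrow> nat set \<Rightarrow> nat \<Rightarrow> nat" where
  "omega d B j = (if j = d then 0 else (LEAST \<alpha>. \<alpha> \<in> submonoid_gen B \<and> [\<alpha> = j] (mod d)))"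

text \<open>\<open>delta B n\<close> is only meaningful for \<open>n \<in> submonoid_gen B\<close> and finite \<open>B\<close>.\<close>
definition delta :: "nat set \<Rightarrow> nat \<Rightarrow> nat" where
  "delta B n = (LEAST m. \<exists>x :: nat \<Rightarrow> nat.
      n = (\<Sum>b\<in>B - {0}. x b * b) \<and> m = (\<Sum>b\<in>B - {0}. x b))"

definition wvec :: "nat \<Rightarrow> nat set \<Rightarrow> nat \<Rightarrow> nat \<times> nat" where
  "wvec d A j = (omega d A j, omega d (reflected d A) (d - j))"

end

theory Submission
  imports Defs
begin

text \<open>
  A vector \<open>u\<close> with \<open>d dvd u\<^sub>1 + u\<^sub>2\<close> lies in \<open>S\<close> iff \<open>u\<^sub>1\<close> is a sum of at most \<open>deg u\<close> nonzero
  elements of \<open>A\<^sub>1\<close>, since shorter sums can be padded with copies of \<open>\<^bold>e\<^sub>0\<close>; exchanging the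
  coordinates gives the same criterion for \<open>u\<^sub>2\<close> and \<open>A\<^sub>2\<close>. It lies in \<open>S'\<close> iff merely
  \<open>u\<^sub>1 \<in> \<langle>A\<^sub>1\<rangle>\<close> and \<open>u\<^sub>2 \<in> \<langle>A\<^sub>2\<rangle>\<close>. Hence \<open>\<^bold>w\<^sub>j \<in> S'\<close>, and both conditions defining the index set say
  \<open>\<^bold>w\<^sub>j \<notin> S\<close>. Finally each \<open>u \<in> S'\<close> with \<open>u\<^sub>1 \<equiv> j\<close> modulo \<open>d\<close> is \<open>\<^bold>w\<^sub>j\<close> plus multiples of \<open>\<^bold>e\<^sub>0\<close> and \<open>\<^bold>e\<^sub>d\<close>.
\<close>

section \<open>Generated submonoids and their coefficient form\<close>

lemma submonoid_gen_add:
  assumes "x \<in> submonoid_gen G" "y \<in> submonoid_gen G"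
  shows "x + y \<in> submonoid_gen G"
  using assms by (induction rule: submonoid_gen.induct) (auto simp: add.assoc intro: submonoid_gen.intros)

lemma submonoid_gen_base: "g \<in> G \<Longrightarrow> g \<in> submonoid_gen G"
  using submonoid_gen.add[OF _ submonoid_gen.zero] by fastforce

lemma submonoid_gen_sum:
  "(\<And>i. i \<in> I \<Longrightarrow> f i \<in> submonoid_gen G) \<Longrightarrow> sum f I \<in> submonoid_gen G"
  by (induction I rule: infinite_finite_induct) (auto intro: submonoid_gen_add submonoid_gen.zero)

lemma submonoid_gen_scale:
  assumes "\<And>x. s 0 x = 0" "\<And>n x. s (Suc n) x = x + s n x" "g \<in> submonoid_gen G"
  shows "s n g \<in> submonoid_gen G"
  by (induction n) (auto simp: assms intro: submonoid_gen_add submonoid_gen.zero)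

lemma submonoid_gen_mult:
  fixes g :: nat
  shows "g \<in> submonoid_gen G \<Longrightarrow> n * g \<in> submonoid_gen G"
  by (rule submonoid_gen_scale[where s = "(*)"]) auto

lemma submonoid_gen_nscale:
  "g \<in> submonoid_gen G \<Longrightarrow> nscale n g \<in> submonoid_gen G"
  by (rule submonoid_gen_scale) (auto simp: nscale_def zero_prod_def prod_eq_iff)

text \<open>Coefficients are indexed by \<open>A\<close> rather than by its image, which lets
  \<open>A1\<close> index the generators of S directly; \<open>f\<close> need not be
  injective.\<close>

lemma submonoid_gen_image_iff:
  assumes "finite A" and s: "\<And>x. s 0 x = 0" "\<And>n x. s (Suc n) x = x + s n x"
  shows "u \<in> submonoid_gen (f ` A) \<longleftrightarrow> (\<exists>c :: 'b \<Rightarrow> nat. u = (\<Sum>a\<in>A. s (c a) (f a)))"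
proof
  assume "u \<in> submonoid_gen (f ` A)"
  then show "\<exists>c. u = (\<Sum>a\<in>A. s (c a) (f a))"
  proof induction
    case zero
    show ?case by (intro exI[of _ "\<lambda>_. 0"]) (simp add: s)
  next
    case (add g x)
    then obtain b c where b: "b \<in> A" "g = f b" "x = (\<Sum>a\<in>A. s (c a) (f a))" by auto
    have "(\<Sum>a\<in>A. s ((c(b := Suc (c b))) a) (f a)) = f b + (\<Sum>a\<in>A. s (c a) (f a))"
      using assms(1) b(1) by (simp add: sum.remove s add.assoc)
    then show ?case using b by metis
  qed
next
  assume "\<exists>c. u = (\<Sum>a\<in>A. s (c a) (f a))"
  then show "u \<in> submonoid_gen (f ` A)"
    using submonoid_gen_scale[of s, OF s submonoid_gen_base] by (auto intro!: submonoid_gen_sum)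
qed

lemma submonoid_gen_nat_iff:
  fixes B :: "nat set"
  assumes "finite B"
  shows "n \<in> submonoid_gen B \<longleftrightarrow> (\<exists>c. n = (\<Sum>b\<in>B. c b * b))"
  using submonoid_gen_image_iff[OF assms, of "(*)" n "\<lambda>b. b"] by simp

section \<open>Membership criteria for S and S'\<close>

lemma delta_le_iff:
  assumes "finite B" "0 \<in> B"
  shows "n \<in> submonoid_gen B \<and> delta B n \<le> m \<longleftrightarrow>
    (\<exists>c. n = (\<Sum>b\<in>B. c b * b) \<and> m = (\<Sum>b\<in>B. c b))"
proof -
  let ?Q = "\<lambda>m. \<exists>x :: nat \<Rightarrow> nat. n = (\<Sum>b\<in>B - {0}. x b * b) \<and> m = (\<Sum>b\<in>B - {0}. x b)"
  have split: "(\<Sum>b\<in>B. c b * b) = (\<Sum>b\<in>B - {0}. c b * b)"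
    "sum c B = c 0 + sum c (B - {0})" for c :: "nat \<Rightarrow> nat"
    using assms by (simp_all add: sum.remove)
  show ?thesis
  proof
    assume *: "n \<in> submonoid_gen B \<and> delta B n \<le> m"
    then have "\<exists>m. ?Q m" using submonoid_gen_nat_iff[OF assms(1)] split(1) by auto
    then have "?Q (delta B n)" unfolding delta_def by (rule LeastI_ex)
    then obtain x where x: "n = (\<Sum>b\<in>B - {0}. x b * b)" "delta B n = (\<Sum>b\<in>B - {0}. x b)" by blast
    \<comment> \<open>Zeros pad the shortest representation to length \<open>m\<close>; the
      subtraction is exact since \<open>delta B n \<le> m\<close>.\<close>
    let ?c = "x(0 := m - delta B n)"
    have "sum ?c (B - {0}) = delta B n" "(\<Sum>b\<in>B - {0}. ?c b * b) = n"
      using x by (auto intro!: sum.cong)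
    then show "\<exists>c. n = (\<Sum>b\<in>B. c b * b) \<and> m = (\<Sum>b\<in>B. c b)"
      using * unfolding split by (intro exI[of _ ?c]) simp
  next
    assume "\<exists>c. n = (\<Sum>b\<in>B. c b * b) \<and> m = (\<Sum>b\<in>B. c b)"
    then obtain c where c: "n = (\<Sum>b\<in>B. c b * b)" "m = (\<Sum>b\<in>B. c b)" by blast
    then have "?Q (sum c (B - {0}))" using split(1) by auto
    then have "delta B n \<le> sum c (B - {0})" unfolding delta_def by (rule Least_le)
    then show "n \<in> submonoid_gen B \<and> delta B n \<le> m"
      using c split(2)[of c] submonoid_gen_nat_iff[OF assms(1)] by auto
  qed
qed

text \<open>Every generator has coordinate sum \<open>d\<close>, so the number of generators used is
  forced to be the degree. The second coordinate is then determined by the first, and copies of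
  \<open>evec d 0\<close> fill up the count.\<close>

lemma S_monoid_iff:
  assumes "finite A" "0 \<in> A" "A \<subseteq> {..d}" "d > 0"
  shows "u \<in> S_monoid d A \<longleftrightarrow>
    d dvd fst u + snd u \<and> fst u \<in> submonoid_gen A \<and> delta A (fst u) \<le> degr d u"
proof -
  have "u \<in> S_monoid d A \<longleftrightarrow> (\<exists>c. u = (\<Sum>a\<in>A. nscale (c a) (evec d a)))"
    unfolding S_monoid_def
    by (rule submonoid_gen_image_iff)
      (auto simp: assms nscale_def zero_prod_def prod_eq_iff)
  also have "\<dots> \<longleftrightarrow> (\<exists>c. fst u = (\<Sum>a\<in>A. c a * a) \<and> snd u = (\<Sum>a\<in>A. c a * (d - a)))"
    by (simp add: prod_eq_iff fst_sum snd_sum nscale_def evec_def)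
  also have "\<dots> \<longleftrightarrow> (\<exists>c. fst u = (\<Sum>a\<in>A. c a * a) \<and> fst u + snd u = d * (\<Sum>a\<in>A. c a))"
  proof -
    have "d * (\<Sum>a\<in>A. c a) = (\<Sum>a\<in>A. c a * a) + (\<Sum>a\<in>A. c a * (d - a))" for c
      using assms(3) unfolding sum.distrib[symmetric] sum_distrib_left
      by (intro sum.cong) (auto simp: distrib_left[symmetric] mult.commute[of d])
    then show ?thesis by (intro ex_cong1) auto
  qed
  also have "\<dots> \<longleftrightarrow> d dvd fst u + snd u \<and>
      (\<exists>c. fst u = (\<Sum>a\<in>A. c a * a) \<and> degr d u = (\<Sum>a\<in>A. c a))"
  proof -
    have "fst u + snd u = d * m \<longleftrightarrow> d dvd fst u + snd u \<and> degr d u = m" for m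
      using assms(4) by (auto simp: degr_def)
    then show ?thesis by auto
  qed
  finally show ?thesis using delta_le_iff[OF assms(1,2)] by simp
qed

lemma reflected_reflected: "A \<subseteq> {..d} \<Longrightarrow> reflected d (reflected d A) = A"
  by (force simp: reflected_def image_image)

text \<open>The swap sends \<open>evec d b\<close> to \<open>evec d (d - b)\<close>. One direction
  suffices, because reflection is an involution.\<close>

lemma S_monoid_swap:
  assumes "A \<subseteq> {..d}" "u \<in> S_monoid d A"
  shows "prod.swap u \<in> S_monoid d (reflected d A)"
  using assms(2) unfolding S_monoid_def
proof induction
  case zero
  show ?case using submonoid_gen.zero[of "evec d ` reflected d A"] by (simp add: zero_prod_def)
next
  case (add g x)
  then obtain b where b: "b \<in> A" "g = evec d b" by auto
  have "prod.swap g = evec d (d - b)" using b assms(1) by (auto simp: evec_def)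
  then have "prod.swap g \<in> evec d ` reflected d A" using b by (auto simp: reflected_def)
  from submonoid_gen.add[OF this add.IH] show ?case by (simp add: plus_prod_def)
qed

lemma S_monoid_iff_snd:
  assumes "finite A" "d \<in> A" "A \<subseteq> {..d}" "d > 0"
  shows "u \<in> S_monoid d A \<longleftrightarrow> d dvd fst u + snd u \<and>
    snd u \<in> submonoid_gen (reflected d A) \<and> delta (reflected d A) (snd u) \<le> degr d u"
proof -
  have "reflected d A \<subseteq> {..d}" by (auto simp: reflected_def)
  then have "u \<in> S_monoid d A \<longleftrightarrow> prod.swap u \<in> S_monoid d (reflected d A)"
    using S_monoid_swap[OF assms(3), of u] S_monoid_swap[of "reflected d A" d "prod.swap u"]
    unfolding reflected_reflected[OF assms(3)] swap_swap by blast
  also have "\<dots> \<longleftrightarrow> d dvd fst u + snd u \<and>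
      snd u \<in> submonoid_gen (reflected d A) \<and> delta (reflected d A) (snd u) \<le> degr d u"
    using assms by (subst S_monoid_iff) (force simp: reflected_def degr_def add.commute)+
  finally show ?thesis .
qed

text \<open>Adding \<open>p\<close> copies of \<open>evec d 0\<close> fixes the first coordinate and
  raises the degree by \<open>p\<close>, so the length bound disappears for large \<open>p\<close>;
  \<open>evec d d\<close> does the same for the second coordinate.\<close>

lemma S_prime_iff:
  assumes "finite A" "0 \<in> A" "d \<in> A" "A \<subseteq> {..d}" "d > 0"
  shows "u \<in> S_prime d A \<longleftrightarrow> d dvd fst u + snd u \<and>
    fst u \<in> submonoid_gen A \<and> snd u \<in> submonoid_gen (reflected d A)"
proof -
  let ?u0 = "\<lambda>p. u + nscale p (evec d 0)" and ?ud = "\<lambda>p. u + nscale p (evec d d)"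
  have coord: "fst (?u0 p) = fst u" "snd (?ud p) = snd u"
    "fst (?u0 p) + snd (?u0 p) = fst u + snd u + p * d"
    "fst (?ud p) + snd (?ud p) = fst u + snd u + p * d" for p
    by (auto simp: nscale_def evec_def)
  have deg: "degr d (?u0 p) \<ge> p" "degr d (?ud p) \<ge> p" for p
    unfolding degr_def coord(3,4) using assms(5) by auto
  have dvd: "d dvd fst u + snd u + p * d \<longleftrightarrow> d dvd fst u + snd u" for p
    by (simp add: dvd_add_left_iff)
  have S0: "?u0 p \<in> S_monoid d A \<longleftrightarrow>
      d dvd fst u + snd u \<and> fst u \<in> submonoid_gen A \<and> delta A (fst u) \<le> degr d (?u0 p)" for p
    unfolding S_monoid_iff[OF assms(1,2,4,5)] coord(3) dvd unfolding coord ..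
  have Sd: "?ud p \<in> S_monoid d A \<longleftrightarrow> d dvd fst u + snd u \<and>
      snd u \<in> submonoid_gen (reflected d A) \<and> delta (reflected d A) (snd u) \<le> degr d (?ud p)" for p
    unfolding S_monoid_iff_snd[OF assms(1,3,4,5)] coord(4) dvd unfolding coord ..
  show ?thesis
  proof
    assume "u \<in> S_prime d A"
    then show "d dvd fst u + snd u \<and> fst u \<in> submonoid_gen A \<and> snd u \<in> submonoid_gen (reflected d A)"
      unfolding S_prime_def mem_Collect_eq S0 Sd by blast
  next
    assume *: "d dvd fst u + snd u \<and> fst u \<in> submonoid_gen A \<and> snd u \<in> submonoid_gen (reflected d A)"
    \<comment> \<open>Both shifted vectors have degree at least \<open>?p\<close>, so this choice
      meets both length bounds at once.\<close>
    let ?p = "max (delta A (fst u)) (delta (reflected d A) (snd u))"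
    have "delta A (fst u) \<le> degr d (?u0 ?p)" "delta (reflected d A) (snd u) \<le> degr d (?ud ?p)"
      using deg[of ?p] by linarith+
    then show "u \<in> S_prime d A" unfolding S_prime_def mem_Collect_eq S0 Sd using * by blast
  qed
qed

section \<open>Minimal representatives of residue classes\<close>

text \<open>The residues attained form a subgroup modulo \<open>d\<close>. The least positive
  element \<open>g\<close> of its preimage \<open>H\<close> divides all of \<open>B\<close>, hence
  equals 1.\<close>

lemma submonoid_gen_cong_ex:
  fixes B :: "nat set"
  assumes "d \<in> B" "d > 0" "Gcd B = 1"
  shows "\<exists>\<alpha>. \<alpha> \<in> submonoid_gen B \<and> [\<alpha> = j] (mod d)"
proof -
  define H where "H = {n. \<exists>m\<in>submonoid_gen B. [m = n] (mod d)}"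
  have H_mult: "n * x \<in> H" if "x \<in> H" for n x
    using that submonoid_gen_mult cong_scalar_left unfolding H_def by blast
  have H_add: "x + y \<in> H" if "x \<in> H" "y \<in> H" for x y
    using that submonoid_gen_add cong_add unfolding H_def by blast
  have H_base: "b \<in> H" if "b \<in> B" for b
    using that submonoid_gen_base cong_refl unfolding H_def by blast
  have H_cong: "y \<in> H" if "x \<in> H" "[x = y] (mod d)" for x y
    using that cong_trans unfolding H_def by blast
  define g where "g = (LEAST g. g > 0 \<and> g \<in> H)"
  have g: "g > 0 \<and> g \<in> H"
    unfolding g_def by (rule LeastI[of _ d]) (use assms H_base in auto)
  have "g dvd b" if "b \<in> B" for b
  proof -
    \<comment> \<open>Modulo \<open>d\<close>, subtracting \<open>g\<close> is adding \<open>(d - 1) * g\<close>, so \<open>H\<close> admits division by \<open>g\<close>.\<close>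
    have "b + (b div g) * ((d - 1) * g) = b mod g + ((b div g) * g) * d"
    proof -
      have "b = b mod g + (b div g) * g" by simp
      moreover have "(b div g) * ((d - 1) * g) + (b div g) * g = ((b div g) * g) * d"
        using assms(2) by (cases d) (auto simp: algebra_simps)
      ultimately show ?thesis by linarith
    qed
    then have "[b + (b div g) * ((d - 1) * g) = b mod g] (mod d)"
      by (simp add: cong_def)
    moreover have "b + (b div g) * ((d - 1) * g) \<in> H"
      using that g by (intro H_add H_mult H_base[OF that]) auto
    ultimately have "b mod g \<in> H" using H_cong by blast
    moreover have "b mod g < g" using g by simp
    ultimately have "b mod g = 0"
      using not_less_Least[of "b mod g" "\<lambda>g. g > 0 \<and> g \<in> H", folded g_def] by simp
    then show ?thesis by auto
  qed
  then have "g dvd Gcd B" by (intro Gcd_greatest)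
  then have "g = 1" using assms(3) by simp
  then have "j \<in> H" using g H_mult[of 1 j] by simp
  then show ?thesis unfolding H_def by blast
qed

lemma omega_mem:
  assumes "d \<in> B" "d > 0" "Gcd B = 1"
  shows "omega d B j \<in> submonoid_gen B" "[omega d B j = j] (mod d)"
proof -
  have "omega d B j \<in> submonoid_gen B \<and> [omega d B j = j] (mod d)"
    using LeastI_ex[OF submonoid_gen_cong_ex[OF assms]]
    by (cases "j = d") (auto simp: omega_def cong_def submonoid_gen.zero)
  then show "omega d B j \<in> submonoid_gen B" "[omega d B j = j] (mod d)" by auto
qed

lemma omega_le:
  assumes "n \<in> submonoid_gen B" "[n = j] (mod d)"
  shows "omega d B j \<le> n"
  using assms unfolding omega_def by (auto intro: Least_le)

lemma omega_eq_self:
  assumes "d \<in> B" "d > 0" "Gcd B = 1" "j \<in> B" "j < d"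
  shows "omega d B j = j"
proof -
  have "omega d B j \<le> j" using assms by (intro omega_le submonoid_gen_base) auto
  then show ?thesis
    using omega_mem(2)[OF assms(1-3), of j] assms(5) by (simp add: cong_def)
qed

lemma omega_decomp:
  assumes "d \<in> B" "d > 0" "Gcd B = 1" "n \<in> submonoid_gen B" "[n = j] (mod d)"
  obtains p where "n = omega d B j + p * d"
proof -
  have "[n = omega d B j] (mod d)"
    using omega_mem(2)[OF assms(1-3), of j] assms(5) by (simp add: cong_def)
  then have "d dvd n - omega d B j"
    using omega_le[OF assms(4,5)] by (simp add: cong_altdef_nat)
  then obtain p where "n - omega d B j = d * p" by (rule dvdE)
  then have "n = omega d B j + p * d"
    using omega_le[OF assms(4,5)] by (simp add: mult.commute)
  then show thesis by (rule that)
qed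

text \<open>Since 0 reflects to \<open>d\<close>, a common divisor of the reflected set divides both
  \<open>d\<close> and \<open>d - x\<close>, hence \<open>x\<close>.\<close>

lemma Gcd_reflected:
  assumes "0 \<in> A" "A \<subseteq> {..d}" "Gcd A = 1"
  shows "Gcd (reflected d A) = 1"
proof -
  let ?g = "Gcd (reflected d A)"
  have dvd: "?g dvd d - x" if "x \<in> A" for x
    using that by (intro Gcd_dvd) (auto simp: reflected_def)
  have "?g dvd x" if "x \<in> A" for x
  proof -
    have "?g dvd d - (d - x)" using dvd_diff_nat[OF dvd[OF assms(1)] dvd[OF that]] by simp
    then show ?thesis using that assms(2) by (auto simp: subset_iff)
  qed
  then have "?g dvd Gcd A" by (intro Gcd_greatest)
  then show ?thesis using assms(3) by simp
qed

section \<open>The index set and the two inclusions\<close>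

theorem lemma3p4:
  fixes k d :: nat and a :: "nat \<Rightarrow> nat" and A1 A2 I :: "nat set"
  assumes "k \<ge> 3"
    and "a 0 = 0"
    and "strict_mono_on {0..k} a"
    and "a k = d"
    and "Gcd (a ` {1..k}) = 1"
    and "A1 = a ` {0..k}"
    and "A2 = reflected d A1"
    and "I = {i. 1 \<le> i \<and> i \<le> d - 1 \<and> i \<notin> a ` {1..k - 1}
                 \<and> delta A1 (fst (wvec d A1 i)) > degr d (wvec d A1 i)}"
  shows "I = {i. 1 \<le> i \<and> i \<le> d - 1 \<and> i \<notin> a ` {1..k - 1}
                 \<and> delta A2 (snd (wvec d A1 i)) > degr d (wvec d A1 i)}
    \<and> wvec d A1 ` I \<subseteq> S_prime d A1 - S_monoid d A1
    \<and> S_prime d A1 - S_monoid d A1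
        \<subseteq> wvec d A1 ` I + range (\<lambda>p. nscale p (evec d 0)) + range (\<lambda>p. nscale p (evec d d))"
proof -
  note A1 = assms(6) and A2 = assms(7)
  have fin: "finite A1" and zero: "0 \<in> A1" and top: "d \<in> A1"
    using A1 assms(2,4) by force+
  have pos: "d > 0"
    using strict_mono_onD[OF assms(3), of 0 k] assms(1,2,4) by simp
  have sub: "A1 \<subseteq> {..d}"
    using strict_mono_onD[OF assms(3), of _ k] assms(4) by (force simp: A1 le_less)
  have "A1 = insert 0 (a ` {1..k})"
    unfolding A1 by (subst atLeastAtMost_insertL[of 0 k, symmetric]) (auto simp: assms(2))
  then have gcd1: "Gcd A1 = 1" using assms(5) by simp
  have gcd2: "Gcd A2 = 1" unfolding A2 by (rule Gcd_reflected[OF zero sub gcd1])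
  have top2: "d \<in> A2" using zero by (force simp: A2 reflected_def)
  note om1 = omega_mem[OF top pos gcd1] and om2 = omega_mem[OF top2 pos gcd2]
  have w: "fst (wvec d A1 i) = omega d A1 i" "snd (wvec d A1 i) = omega d A2 (d - i)" for i
    by (simp_all add: wvec_def A2)
  \<comment> \<open>The coordinates have residues \<open>i\<close> and \<open>d - i\<close>, which
    add up to \<open>d\<close>.\<close>
  have w_dvd: "d dvd fst (wvec d A1 i) + snd (wvec d A1 i)" if "i \<le> d" for i
    using cong_add[OF om1(2)[of i] om2(2)[of "d - i"]] that by (simp add: w cong_def dvd_eq_mod_eq_0)
  have w_S': "wvec d A1 i \<in> S_prime d A1" if "i \<le> d" for i
    using w_dvd[OF that] om1 om2
    unfolding S_prime_iff[OF fin zero top sub pos] A2[symmetric] by (simp add: w)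
  have w_S1: "wvec d A1 i \<in> S_monoid d A1 \<longleftrightarrow> delta A1 (fst (wvec d A1 i)) \<le> degr d (wvec d A1 i)"
    if "i \<le> d" for i
    using w_dvd[OF that] om1 unfolding S_monoid_iff[OF fin zero sub pos] by (simp add: w)
  have w_S2: "wvec d A1 i \<in> S_monoid d A1 \<longleftrightarrow> delta A2 (snd (wvec d A1 i)) \<le> degr d (wvec d A1 i)"
    if "i \<le> d" for i
    using w_dvd[OF that] om2
    unfolding S_monoid_iff_snd[OF fin top sub pos] A2[symmetric] by (simp add: w)
  \<comment> \<open>This form of the index set no longer favours a coordinate, so
    \<open>w_S2\<close> turns it into the condition on \<open>A2\<close>.\<close>
  have I: "i \<in> I \<longleftrightarrow> 1 \<le> i \<and> i \<le> d - 1 \<and> i \<notin> a ` {1..k - 1} \<and> wvec d A1 i \<notin> S_monoid d A1" for i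
    unfolding assms(8) using w_S1[of i] by (cases "i \<le> d") (auto simp: not_le)
  \<comment> \<open>For these indices \<open>wvec d A1 i\<close> is 0 or a generator. At
    \<open>i = 0\<close> the convention \<open>omega d A2 d = 0\<close> enters; for
    \<open>i > 0\<close> one has \<open>d - i < d\<close>, as \<open>omega_eq_self\<close>
    requires.\<close>
  have w_self: "wvec d A1 i \<in> S_monoid d A1" if "i \<in> A1" "i < d" for i
  proof (cases "i = 0")
    case True
    then have "wvec d A1 i = 0"
      using omega_eq_self[OF top pos gcd1 zero pos] by (simp add: prod_eq_iff w omega_def[of d A2])
    then show ?thesis by (simp add: S_monoid_def submonoid_gen.zero)
  next
    case False
    then have "omega d A2 (d - i) = d - i"
      using that(1) pos by (intro omega_eq_self[OF top2 pos gcd2]) (auto simp: A2 reflected_def)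
    then have "wvec d A1 i = evec d i"
      using omega_eq_self[OF top pos gcd1 that] by (simp add: prod_eq_iff w evec_def)
    then show ?thesis using that(1) by (auto simp: S_monoid_def intro: submonoid_gen_base)
  qed
  have "I = {i. 1 \<le> i \<and> i \<le> d - 1 \<and> i \<notin> a ` {1..k - 1}
                 \<and> delta A2 (snd (wvec d A1 i)) > degr d (wvec d A1 i)}"
    using I w_S2 by (auto simp: not_le[symmetric])
  moreover have "wvec d A1 ` I \<subseteq> S_prime d A1 - S_monoid d A1"
    using I w_S' by auto
  moreover have "u \<in> wvec d A1 ` I + range (\<lambda>p. nscale p (evec d 0)) + range (\<lambda>p. nscale p (evec d d))"
    if u: "u \<in> S_prime d A1 - S_monoid d A1" for u
  proof -
    have u': "d dvd fst u + snd u" "fst u \<in> submonoid_gen A1" "snd u \<in> submonoid_gen A2"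
      using u unfolding Diff_iff S_prime_iff[OF fin zero top sub pos] A2 by blast+
    define j where "j = fst u mod d"
    have j: "j < d" "[fst u = j] (mod d)" using pos by (simp_all add: j_def cong_def)
    \<comment> \<open>Both sides vanish modulo \<open>d\<close>; adding \<open>j\<close> avoids
      negative residues and is cancelled afterwards.\<close>
    have "[snd u + j = (d - j) + j] (mod d)"
    proof -
      have "[snd u + j = snd u + fst u] (mod d)"
        using j(2) by (intro cong_add cong_refl) (rule cong_sym)
      also have "[snd u + fst u = (d - j) + j] (mod d)"
        using u'(1) j(1) by (simp add: cong_def dvd_eq_mod_eq_0 add.commute)
      finally show ?thesis .
    qed
    then have j2: "[snd u = d - j] (mod d)" by (simp only: cong_add_rcancel_nat)
    obtain p where p: "fst u = omega d A1 j + p * d"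
      by (rule omega_decomp[OF top pos gcd1 u'(2) j(2)])
    obtain q where q: "snd u = omega d A2 (d - j) + q * d"
      by (rule omega_decomp[OF top2 pos gcd2 u'(3) j2])
    have u_eq: "u = wvec d A1 j + nscale q (evec d 0) + nscale p (evec d d)"
      using p q by (simp add: prod_eq_iff w nscale_def evec_def)
    \<comment> \<open>Otherwise \<open>u\<close> would lie in S, as \<open>evec d 0\<close> and
      \<open>evec d d\<close> are themselves generators.\<close>
    have "wvec d A1 j \<notin> S_monoid d A1"
    proof
      assume "wvec d A1 j \<in> S_monoid d A1"
      then have "u \<in> S_monoid d A1"
        unfolding u_eq S_monoid_def using zero top
        by (auto intro!: submonoid_gen_add submonoid_gen_nscale intro: submonoid_gen_base)
      then show False using u by blast
    qed
    moreover from this have "j \<notin> A1" using w_self j(1) by blast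
    moreover from this zero have "j \<noteq> 0" by metis
    ultimately have "j \<in> I" unfolding I using j(1) A1 by force
    then show ?thesis unfolding u_eq by (intro set_plus_intro imageI rangeI)
  qed
  ultimately show ?thesis by blast
qed

end
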